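(* Let $d,N\in\mathbb N$ and let $X\subseteq\mathbb T^d$, $\#X=N$, be a Latin hypercube set with a single distance vector. Let $f:\mathbb T\to(0,\infty)$ be a potential such that $g=\log f:\mathbb T\to\mathbb R$ is $N$-equispacing. Then $$E_F(Y)\ \ge\ E_F(X)$$ for every $N$-point configuration $Y\subseteq\mathbb T^d$, $\#Y=N$.
   Context: $\mathbb T=\mathbb R/\mathbb Z$ is identified with $[0,1)$. A potential $f$ on $\mathbb T$ is viewed as a $1$-periodic function on $\mathbb R$ and is assumed to be even and continuous on $(0,1)$. Energy: given $f$ and $d$, put $F(t_1,\dots,t_d)=f(t_1)\cdots f(t_d)$; for a (multi)set $X=\{\mathbf x^0,\dots,\mathbf x^{N-1}\}$ of points $\mathbf x^k=(x^k_1,\dots,x^k_d)\in\mathbb T^d$, $$E_F(X)=\sum_{k,\ell=0,\ k\ne\ell}^{N-1}\ \prod_{i=1}^d f(x_i^k-x_i^\ell).$$ $N$-equispacing: a function $g$ on $\mathbb T$ is $N$-equispacing if for all $x^0,\dots,x^{N-1}\in[0,1)$ one has $\sum_{k\ne\ell}g(x^k-x^\ell)\ge\sum_{k\neq\ell}g\left(\frac kN-\frac\ell N\right)$ (sums over ordered pairs $k\ne\ell$ in $\{0,\dots,N-1\}$). Latin hypercube set: a set of the form $\left\{\left(\frac kN,\frac{\sigma_2(k)}N,\dots,\frac{\sigma_d(k)}N\right):k=0,\dots,N-1\right\}$ with $\sigma_2,\dots,\sigma_d$ permutations of $\{0,\dots,N-1\}$. Distance vector: for $x,y\in[0,1)$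 let $\delta(x,y)=\min\{|x-y|,1-|x-y|\}$. For $\mathbf x,\mathbf y\in\mathbb T^d$, $\operatorname{dv}(\mathbf x,\mathbf y)$ is the vector of the numbers $\delta(x_1,y_1),\dots,\delta(x_d,y_d)$ sorted in increasing order. $X$ has a single distance vector if the set $\{\operatorname{dv}(\mathbf x^k,\mathbf x^\ell):k\ne\ell\}$ has exactly one element. *)

theory Defs
  imports Complex_Main "HOL-Library.FuncSet" "HOL-Combinatorics.Permutations"
begin

text \<open>
  The circle \<open>\<real>/\<int>\<close> is identified with \<open>[0,1)\<close>. Coordinates of points of the
  \<open>d\<close>-dimensional torus are indexed by \<open>{1..d}\<close>; points are extensional functions (undefined
  outside \<open>{1..d}\<close>), so that equality of functions is equality of points and \<^const>\<open>card\<close>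
  counts points.
\<close>

definition torus :: "nat \<Rightarrow> (nat \<Rightarrow> real) set" where
  "torus d = {1..d} \<rightarrow>\<^sub>E {0..<1}"

text \<open>A potential on the circle is viewed as a 1-periodic function on the real line.\<close>

definition potential :: "(real \<Rightarrow> real) \<Rightarrow> bool" where
  "potential f \<longleftrightarrow>
     (\<forall>t. f (t + 1) = f t) \<and> (\<forall>t. f (- t) = f t) \<and> continuous_on {0<..<1} f"

definition tensor_potential :: "nat \<Rightarrow> (real \<Rightarrow> real) \<Rightarrow> (nat \<Rightarrow> real) \<Rightarrow> real" where
  "tensor_potential d f t = (\<Prod>i\<in>{1..d}. f (t i))"

text \<open>
  An \<open>N\<close>-point multiset is given by an enumeration \<open>x 0, \<dots>, x (N - 1)\<close>, possibly with
  repetitions; \<open>x k i\<close> is the \<open>i\<close>-th coordinate of the \<open>k\<close>-th point.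
\<close>

definition energy :: "nat \<Rightarrow> ((nat \<Rightarrow> real) \<Rightarrow> real) \<Rightarrow> (nat \<Rightarrow> nat \<Rightarrow> real) \<Rightarrow> real" where
  "energy N F x =
     (\<Sum>(k, l) \<in> {(k, l). k < N \<and> l < N \<and> k \<noteq> l}. F (\<lambda>i. x k i - x l i))"

definition equispacing :: "nat \<Rightarrow> (real \<Rightarrow> real) \<Rightarrow> bool" where
  "equispacing N g \<longleftrightarrow>
     (\<forall>x :: nat \<Rightarrow> real. (\<forall>k<N. x k \<in> {0..<1}) \<longrightarrow>
        (\<Sum>(k, l) \<in> {(k, l). k < N \<and> l < N \<and> k \<noteq> l}. g (x k - x l))
        \<ge> (\<Sum>(k, l) \<in> {(k, l). k < N \<and> l < N \<and> k \<noteq> l}. g (real k / real N - real l / real N)))"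

definition latin_hypercube :: "nat \<Rightarrow> nat \<Rightarrow> (nat \<Rightarrow> real) set \<Rightarrow> bool" where
  "latin_hypercube d N X \<longleftrightarrow>
     (\<exists>\<sigma> :: nat \<Rightarrow> nat \<Rightarrow> nat. (\<forall>i\<in>{2..d}. \<sigma> i permutes {..<N}) \<and>
        X = {(\<lambda>i\<in>{1..d}. if i = 1 then real k / real N else real (\<sigma> i k) / real N) | k. k < N})"

definition circle_dist :: "real \<Rightarrow> real \<Rightarrow> real" where
  "circle_dist s t = min \<bar>s - t\<bar> (1 - \<bar>s - t\<bar>)"

definition distance_vector :: "nat \<Rightarrow> (nat \<Rightarrow> real) \<Rightarrow> (nat \<Rightarrow> real) \<Rightarrow> real list" where
  "distance_vector d x y = sort (map (\<lambda>i. circle_dist (x i) (y i)) [1..<Suc d])"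

definition single_distance_vector :: "nat \<Rightarrow> (nat \<Rightarrow> real) set \<Rightarrow> bool" where
  "single_distance_vector d X \<longleftrightarrow>
     card {distance_vector d x y | x y. x \<in> X \<and> y \<in> X \<and> x \<noteq> y} = 1"

end

theory Submission
  imports Defs
begin

text \<open>
  The energy of a configuration is the sum over ordered pairs of \<open>exp\<close> of the additive pair energy
  \<open>\<Sum>i. ln (f (x k i - x l i))\<close>. Equispacing, applied in each coordinate, shows that a Latin
  hypercube minimises the total additive energy, and the single distance vector makes all its pair
  energies equal. Convexity of \<open>exp\<close> (Jensen, with equality for constant terms) then transfers
  minimality to the sum of exponentials.
\<close>

text \<open>Jensen's inequality with one side constant: \<open>exp\<close> lies above its tangent
  line at \<open>c\<close>, and the linear terms of the tangent sum to something nonnegative by the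
  assumption.\<close>

lemma sum_exp_ge_sum_exp_const:
  fixes u :: "'a \<Rightarrow> real"
  assumes "(\<Sum>p\<in>A. u p) \<ge> (\<Sum>p\<in>A. c)"
  shows "(\<Sum>p\<in>A. exp (u p)) \<ge> (\<Sum>p\<in>A. exp c)"
proof -
  have "(\<Sum>p\<in>A. exp c) \<le> (\<Sum>p\<in>A. exp c) + exp c * ((\<Sum>p\<in>A. u p) - (\<Sum>p\<in>A. c))"
    using assms by simp
  also have "\<dots> = (\<Sum>p\<in>A. exp c * (1 + (u p - c)))"
    by (simp only: distrib_left mult_1_right sum.distrib sum_distrib_left[symmetric] sum_subtractf)
  \<comment> \<open>The tangent bound \<open>1 + s \<le> exp s\<close> at
    \<open>s = u p - c\<close>, scaled by \<open>exp c\<close>.\<close>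
  also have "\<dots> \<le> (\<Sum>p\<in>A. exp c * exp (u p - c))"
    by (intro sum_mono mult_left_mono exp_ge_add_one_self) simp
  finally show ?thesis
    by (simp add: exp_diff)
qed

text \<open>A bijection applied to both indices permutes the off-diagonal pairs. This removes the
  permutations of a Latin hypercube from sums over a single coordinate.\<close>

lemma sum_offdiag_reindex:
  fixes h :: "nat \<Rightarrow> nat \<Rightarrow> real"
  assumes "bij_betw \<tau> {..<N} {..<N}"
  shows "(\<Sum>(k, l) \<in> {(k, l). k < N \<and> l < N \<and> k \<noteq> l}. h (\<tau> k) (\<tau> l)) =
         (\<Sum>(k, l) \<in> {(k, l). k < N \<and> l < N \<and> k \<noteq> l}. h k l)"
proof -
  let ?P = "{(k, l). k < N \<and> l < N \<and> k \<noteq> l}"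
  have inj: "inj_on \<tau> {..<N}" and img: "\<tau> ` {..<N} = {..<N}"
    using assms by (auto simp: bij_betw_def)
  have "map_prod \<tau> \<tau> ` ?P = ?P"
  proof (intro equalityI subsetI)
    fix p assume "p \<in> map_prod \<tau> \<tau> ` ?P"
    then show "p \<in> ?P"
      using inj img by (auto simp: inj_on_def)
  next
    fix p assume "p \<in> ?P"
    then obtain k l where p: "p = (k, l)" "k \<in> \<tau> ` {..<N}" "l \<in> \<tau> ` {..<N}" "k \<noteq> l"
      using img by auto
    then obtain a b where "k = \<tau> a" "l = \<tau> b" "a < N" "b < N"
      by auto
    with p show "p \<in> map_prod \<tau> \<tau> ` ?P"
      by (intro image_eqI[of _ _ "(a, b)"]) auto
  qed
  moreover have "inj_on (map_prod \<tau> \<tau>) ?P"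
    using inj by (auto simp: inj_on_def)
  ultimately have "bij_betw (map_prod \<tau> \<tau>) ?P ?P"
    by (simp add: bij_betw_def)
  from sum.reindex_bij_betw[OF this, of "\<lambda>(k, l). h k l"] show ?thesis
    by (simp add: case_prod_unfold)
qed

text \<open>Evenness handles the branch \<open>\<bar>s - t\<bar>\<close> of the minimum; periodicity
  followed by evenness handles \<open>1 - \<bar>s - t\<bar>\<close>.\<close>

lemma potential_circle_dist:
  assumes "potential f"
  shows "f (circle_dist s t) = f (s - t)"
proof -
  have per: "f (r + 1) = f r" and even: "f (- r) = f r" for r
    using assms by (auto simp: potential_def)
  have "f \<bar>s - t\<bar> = f (s - t)"
    using even[of "s - t"] by (simp add: abs_if)
  moreover have "f (1 - \<bar>s - t\<bar>) = f \<bar>s - t\<bar>"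
    using per[of "- \<bar>s - t\<bar>"] even[of "\<bar>s - t\<bar>"] by simp
  ultimately show ?thesis
    by (simp add: circle_dist_def min_def)
qed

text \<open>A product ignores the order of its factors, so sorting loses nothing: the interaction of
  two points depends only on their distance vector.\<close>

lemma prod_mset_distance_vector:
  assumes "potential f"
  shows "prod_mset (image_mset f (mset (distance_vector d x y))) =
         tensor_potential d f (\<lambda>i. x i - y i)"
proof -
  have "prod_mset (image_mset f (mset (distance_vector d x y))) =
        prod_list (map (\<lambda>i. f (x i - y i)) [1..<Suc d])"
    by (simp add: distance_vector_def potential_circle_dist[OF assms] multiset.map_comp o_def
        flip: mset_map prod_mset_prod_list)
  also have "\<dots> = (\<Prod>i\<in>{1..d}. f (x i - y i))"
    by (subst prod.distinct_set_conv_list[symmetric]) (auto intro!: prod.cong)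
  finally show ?thesis
    by (simp add: tensor_potential_def)
qed

lemma tensor_potential_eq_exp:
  assumes "\<And>t. f t > 0"
  shows "tensor_potential d f t = exp (\<Sum>i\<in>{1..d}. ln (f (t i)))"
  using assms by (simp add: tensor_potential_def exp_sum)

text \<open>The enumeration \<open>x\<close> of \<open>X\<close> is arbitrary, so it is first
  compared with the enumeration \<open>p\<close> by first coordinate. Each coordinate of
  \<open>x\<close> is then a permutation composed with this relabelling.\<close>

lemma latin_hypercube_coordinate_bij:
  assumes "latin_hypercube d N X" "card X = N" "bij_betw x {..<N} X" "i \<in> {1..d}"
  obtains \<tau> where "bij_betw \<tau> {..<N} {..<N}" "\<And>k. k < N \<Longrightarrow> x k i = real (\<tau> k) / real N"
proof -
  obtain \<sigma> where \<sigma>: "\<And>i. i \<in> {2..d} \<Longrightarrow> \<sigma> i permutes {..<N}"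
    and X: "X = {(\<lambda>i\<in>{1..d}. if i = 1 then real k / real N else real (\<sigma> i k) / real N) | k. k < N}"
    using assms(1) unfolding latin_hypercube_def by blast
  define p where
    "p k = (\<lambda>i\<in>{1..d}. if i = 1 then real k / real N else real (\<sigma> i k) / real N)" for k
  \<comment> \<open>The first coordinate is not permuted; \<open>id\<close> lets it be treated like
    the others.\<close>
  define \<rho> where "\<rho> = (if i = 1 then id else \<sigma> i)"
  have "X = p ` {..<N}"
    by (auto simp: X p_def)
  \<comment> \<open>Injectivity comes from counting: \<open>p\<close> maps \<open>N\<close> indices
    onto \<open>N\<close> points.\<close>
  with assms(2) have p: "bij_betw p {..<N} X"
    by (auto simp: bij_betw_def intro!: eq_card_imp_inj_on)
  define \<pi> where "\<pi> = the_inv_into {..<N} p \<circ> x"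
  have \<pi>: "bij_betw \<pi> {..<N} {..<N}"
    unfolding \<pi>_def using bij_betw_trans[OF assms(3) bij_betw_the_inv_into[OF p]] .
  have "\<rho> permutes {..<N}"
    using \<sigma>[of i] assms(4) by (auto simp: \<rho>_def permutes_id)
  then have "bij_betw (\<rho> \<circ> \<pi>) {..<N} {..<N}"
    using bij_betw_trans[OF \<pi> permutes_imp_bij] by blast
  moreover have "x k i = real ((\<rho> \<circ> \<pi>) k) / real N" if "k < N" for k
  proof -
    have "x k \<in> X"
      using assms(3) that by (auto simp: bij_betw_def)
    then have "p (\<pi> k) = x k"
      using p by (simp add: \<pi>_def f_the_inv_into_f_bij_betw)
    then have "x k i = p (\<pi> k) i"
      by simp
    then show ?thesis
      using assms(4) by (simp add: p_def \<rho>_def)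
  qed
  ultimately show ?thesis
    using that by blast
qed

theorem theorem2p3:
  fixes d N :: nat
    and X :: "(nat \<Rightarrow> real) set"
    and f :: "real \<Rightarrow> real"
    and x y :: "nat \<Rightarrow> nat \<Rightarrow> real"
  assumes "d \<ge> 1" and "N \<ge> 1"
    and "X \<subseteq> torus d" and "card X = N"
    and "latin_hypercube d N X"
    and "single_distance_vector d X"
    and "potential f" and "\<And>t. f t > 0"
    and "equispacing N (\<lambda>t. ln (f t))"
    and "bij_betw x {..<N} X"
    and "\<And>k. k < N \<Longrightarrow> y k \<in> torus d"
  shows "energy N (tensor_potential d f) y \<ge> energy N (tensor_potential d f) x"
proof -
  define P where "P = {(k, l). k < N \<and> l < N \<and> k \<noteq> l}"
  define S where "S z = (\<lambda>(k, l). \<Sum>i\<in>{1..d}. ln (f (z k i - z l i)))"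
    for z :: "nat \<Rightarrow> nat \<Rightarrow> real"
  have energy: "energy N (tensor_potential d f) z = (\<Sum>p\<in>P. exp (S z p))" for z
    by (simp add: energy_def P_def S_def tensor_potential_eq_exp[OF assms(8)] case_prod_unfold)
  \<comment> \<open>With the coordinate sum outermost, equispacing can be applied to one coordinate
    at a time.\<close>
  have swap: "(\<Sum>p\<in>P. S z p) = (\<Sum>i\<in>{1..d}. \<Sum>(k, l)\<in>P. ln (f (z k i - z l i)))" for z
    unfolding S_def case_prod_unfold by (rule sum.swap)
  have "(\<Sum>(k, l)\<in>P. ln (f (x k i - x l i))) \<le> (\<Sum>(k, l)\<in>P. ln (f (y k i - y l i)))"
    if i: "i \<in> {1..d}" for i
  proof -
    obtain \<tau> where \<tau>: "bij_betw \<tau> {..<N} {..<N}" "\<And>k. k < N \<Longrightarrow> x k i = real (\<tau> k) / real N"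
      using latin_hypercube_coordinate_bij[OF assms(5,4,10) i] by blast
    have "(\<Sum>(k, l)\<in>P. ln (f (x k i - x l i))) =
          (\<Sum>(k, l)\<in>P. ln (f (real (\<tau> k) / real N - real (\<tau> l) / real N)))"
      by (rule sum.cong) (auto simp: P_def \<tau>(2))
    also have "\<dots> = (\<Sum>(k, l)\<in>P. ln (f (real k / real N - real l / real N)))"
      unfolding P_def by (rule sum_offdiag_reindex[OF \<tau>(1)])
    also have "\<dots> \<le> (\<Sum>(k, l)\<in>P. ln (f (y k i - y l i)))"
    proof -
      have "\<forall>k<N. y k i \<in> {0..<1}"
        using assms(11) i unfolding torus_def by (blast dest: PiE_mem)
      with assms(9) show ?thesis
        unfolding equispacing_def P_def by (elim allE[of _ "\<lambda>k. y k i"]) simp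
    qed
    finally show ?thesis .
  qed
  then have le: "(\<Sum>p\<in>P. S x p) \<le> (\<Sum>p\<in>P. S y p)"
    unfolding swap by (rule sum_mono)
  obtain v where v: "{distance_vector d a b | a b. a \<in> X \<and> b \<in> X \<and> a \<noteq> b} = {v}"
    using assms(6) unfolding single_distance_vector_def by (rule card_1_singletonE)
  \<comment> \<open>The additive pair energy dictated by the only distance vector \<open>v\<close>,
    hence shared by all pairs of distinct points of \<open>X\<close>.\<close>
  define c where "c = ln (prod_mset (image_mset f (mset v)))"
  have const: "S x p = c" if p: "p \<in> P" for p
  proof -
    obtain k l where kl: "p = (k, l)" "k < N" "l < N" "k \<noteq> l"
      using p by (auto simp: P_def)
    then have "x k \<in> X" "x l \<in> X" "x k \<noteq> x l"
      using assms(10) by (auto simp: bij_betw_def inj_on_def)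
    then have "distance_vector d (x k) (x l) = v"
      using v by blast
    then have "c = ln (tensor_potential d f (\<lambda>i. x k i - x l i))"
      using prod_mset_distance_vector[OF assms(7), of d "x k" "x l"] by (simp add: c_def)
    then show ?thesis
      by (simp add: kl(1) S_def tensor_potential_eq_exp[OF assms(8)])
  qed
  \<comment> \<open>By \<open>const\<close>, the left side of \<open>le\<close> is a sum of copies
    of \<open>c\<close>, and the energy of \<open>x\<close> is the matching sum of
    \<open>exp c\<close>.\<close>
  show ?thesis
    using sum_exp_ge_sum_exp_const[where A = P and c = c and u = "S y"] le by (simp add: energy const)
qed

end
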